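(* Let $\{n_k\}_{k=1}^{\infty}$ and $\{m_k\}_{k=1}^{\infty}$ be two sequences of natural numbers (positive integers) such that, for some positive constants $C_1,C_2,C_3$, one has $n_k\le C_1k$, $m_k\le C_2k$ and $|n_k-m_k|\ge C_3\sqrt{k}$ for all $k=1,2,\dots$. Then $$\liminf_{k\to\infty}\underline{\square}_1\big(SO(n_k),SO(m_k)\big)\ \ge\ \min\Big\{\frac12,\ \frac{C_3}{\sqrt{C_1}+\sqrt{C_2}}\Big\}.$$ In particular, if in addition $|n_k-m_k|\ge C_4k^{\alpha}$, $k=1,2,\dots$, holds for some constant $C_4>0$ and some number $\alpha>1/2$, then $$\liminf_{k\to\infty}\underline{\square}_1\big(SO(n_k),SO(m_k)\big)\ \ge\ \frac12.$$
   Context: An mm-space is a triple $(X,d_X,\mu_X)$ where $d_X$ is a complete separable metric on $X$ and $\mu_X$ is a finite Borel measure on $X$. For an mm-space with $\mu_X(X)=1$, a parameter of $X$ is a Borel measurable map $\varphi:[0,1]\to X$ with $\varphi_*(\mathcal{L})=\mu_X$, where $\mathcal{L}$ is Lebesgue measure on $[0,1]$; parameters always exist. For two functions $d_1,d_2:[0,1]\times[0,1]\to\mathbb{R}$, $\square_1(d_1,d_2)$ is the infimum of all $\varepsilon>0$ such that there is a measurable set $T_\varepsilon\subseteq[0,1]$ with $\mathcal{L}(T_\varepsilon)\ge 1-\varepsilon$ and $|d_1(s,t)-d_2(s,t)|\le\varepsilon$ for all $s,t\in T_\varepsilon$. Gromov's box distance between two mm-spaces $X,Y$ with $\mu_X(X)=\mu_Y(Y)=1$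 is $\underline{\square}_1(X,Y):=\inf\square_1(\varphi_X^*d_X,\varphi_Y^*d_Y)$, where the infimum is over all parameters $\varphi_X$ of $X$ and $\varphi_Y$ of $Y$, and $\varphi_X^*d_X(s,t):=d_X(\varphi_X(s),\varphi_X(t))$. The special orthogonal group $SO(n)$ is regarded as an mm-space with the distance $d_n(A,B)=\|A-B\|_{HS}$ induced by the Hilbert–Schmidt norm $\|A\|_{HS}=\sqrt{\operatorname{tr}(A^{T}A)}$ on $n\times n$ real matrices, and with its Haar probability measure. *)

theory Defs
  imports "HOL-Analysis.Analysis" "HOL-Probability.Probability" "Jordan_Normal_Form.Determinant"
begin

hide_const (open) Determinants.det Determinants.trace

section \<open>Metric measure spaces and the box distance\<close>

type_synonym 'a mm = "'a metric \<times> 'a measure"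

definition borel_of_metric :: "'a metric \<Rightarrow> 'a measure" where
  "borel_of_metric X = sigma (mspace X) {U. openin (mtopology_of X) U}"

definition mm_space :: "'a mm \<Rightarrow> bool" where
  "mm_space = (\<lambda>(X, \<mu>). mcomplete_of X \<and> separable_space (mtopology_of X) \<and>
     sets \<mu> = sets (borel_of_metric X) \<and> finite_measure \<mu>)"

abbreviation unit_lebesgue :: "real measure" where
  "unit_lebesgue \<equiv> restrict_space lborel {0..1}"

definition parameters :: "'a mm \<Rightarrow> (real \<Rightarrow> 'a) set" where
  "parameters = (\<lambda>(X, \<mu>).
     {\<phi>. \<phi> \<in> measurable unit_lebesgue (borel_of_metric X) \<and>
          distr unit_lebesgue (borel_of_metric X) \<phi> = \<mu>})"

text \<open>
  Only the values on the unit square matter. Infima are taken in \<^typ>\<open>ereal\<close>; every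
  \<open>\<epsilon> \<ge> 1\<close> is admissible (with \<open>T = {}\<close>), so this is a number in the unit interval.
\<close>

definition box1 :: "(real \<Rightarrow> real \<Rightarrow> real) \<Rightarrow> (real \<Rightarrow> real \<Rightarrow> real) \<Rightarrow> ereal" where
  "box1 d1 d2 = Inf {ereal \<epsilon> | \<epsilon>. \<epsilon> > 0 \<and>
     (\<exists>T \<in> sets lebesgue. T \<subseteq> {0..1} \<and> measure lebesgue T \<ge> 1 - \<epsilon> \<and>
        (\<forall>s\<in>T. \<forall>t\<in>T. \<bar>d1 s t - d2 s t\<bar> \<le> \<epsilon>))}"

text \<open>
  Meant for complete separable metric spaces with a Borel measure of total mass 1: these have
  parameters, so both infima range over nonempty sets.
\<close>

definition box_dist :: "'a mm \<Rightarrow> 'b mm \<Rightarrow> ereal" where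
  "box_dist X Y = (INF \<phi> \<in> parameters X. INF \<psi> \<in> parameters Y.
     box1 (\<lambda>s t. mdist (fst X) (\<phi> s) (\<phi> t)) (\<lambda>s t. mdist (fst Y) (\<psi> s) (\<psi> t)))"


section \<open>The special orthogonal group\<close>

definition SO :: "nat \<Rightarrow> real mat set" where
  "SO n = {A \<in> carrier_mat n n. transpose_mat A * A = 1\<^sub>m n \<and> det A = 1}"

definition mat_trace :: "real mat \<Rightarrow> real" where
  "mat_trace A = (\<Sum>i<dim_row A. A $$ (i, i))"

definition hs_norm :: "real mat \<Rightarrow> real" where
  "hs_norm A = sqrt (mat_trace (transpose_mat A * A))"

text \<open>
  The type \<^typ>\<open>'a metric\<close> needs a symmetric function on the whole type, and subtraction of
  matrices of different dimensions is not symmetric; hence the value 0 outside \<open>SO n\<close>.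
  The lemma \<open>mdist_SO\<close> below gives the distance on \<open>SO n\<close>.
\<close>

definition SO_metric :: "nat \<Rightarrow> real mat metric" where
  "SO_metric n = metric (SO n, \<lambda>A B. if A \<in> SO n \<and> B \<in> SO n then hs_norm (A - B) else 0)"

text \<open>
  A left-invariant Borel probability measure on the compact group \<open>SO n\<close> exists and is unique, and
  is the Haar probability measure.
\<close>

definition haar_prob_SO :: "nat \<Rightarrow> real mat measure \<Rightarrow> bool" where
  "haar_prob_SO n \<mu> \<longleftrightarrow> prob_space \<mu> \<and> sets \<mu> = sets (borel_of_metric (SO_metric n)) \<and>
     (\<forall>A \<in> SO n. distr \<mu> \<mu> (\<lambda>B. A * B) = \<mu>)"

lemma hs_norm_L2:
  assumes A: "A \<in> carrier_mat n n"
  shows "hs_norm A = L2_set (\<lambda>(i, j). A $$ (i, j)) ({..<n} \<times> {..<n})"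
proof -
  have "mat_trace (transpose_mat A * A) = (\<Sum>j<n. \<Sum>i<n. (A $$ (i, j))\<^sup>2)"
    using A by (auto simp: mat_trace_def scalar_prod_def power2_eq_square lessThan_atLeast0
        intro!: sum.cong)
  also have "\<dots> = (\<Sum>(i, j)\<in>{..<n} \<times> {..<n}. (A $$ (i, j))\<^sup>2)"
    by (subst sum.swap) (simp add: sum.cartesian_product)
  finally show ?thesis
    by (simp add: hs_norm_def L2_set_def case_prod_unfold)
qed

lemma hs_dist_L2:
  assumes "A \<in> carrier_mat n n" "B \<in> carrier_mat n n"
  shows "hs_norm (A - B) = L2_set (\<lambda>p. A $$ p - B $$ p) ({..<n} \<times> {..<n})"
  using assms by (subst hs_norm_L2[of _ n]) (auto intro!: L2_set_cong)

lemma SO_carrier: "A \<in> SO n \<Longrightarrow> A \<in> carrier_mat n n"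
  by (simp add: SO_def)

lemma Metric_space_SO:
  "Metric_space (SO n) (\<lambda>A B. if A \<in> SO n \<and> B \<in> SO n then hs_norm (A - B) else 0)"
    (is "Metric_space _ ?d")
proof
  show "0 \<le> ?d A B" for A B
    by (auto simp: hs_dist_L2 dest!: SO_carrier)
  show "?d A B = ?d B A" for A B
    by (auto simp: hs_dist_L2 L2_set_def power2_commute dest!: SO_carrier)
  show "?d A B = 0 \<longleftrightarrow> A = B" if "A \<in> SO n" "B \<in> SO n" for A B
    using that SO_carrier[OF that(1)] SO_carrier[OF that(2)]
    by (auto simp: hs_dist_L2 L2_set_eq_0_iff)
  show "?d A C \<le> ?d A B + ?d B C" if "A \<in> SO n" "B \<in> SO n" "C \<in> SO n" for A B C
    using that SO_carrier[OF that(1)] SO_carrier[OF that(2)] SO_carrier[OF that(3)]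
      L2_set_triangle_ineq[of "\<lambda>p. A $$ p - B $$ p" "\<lambda>p. B $$ p - C $$ p" "{..<n} \<times> {..<n}"]
    by (simp add: hs_dist_L2)
qed

lemma mspace_SO [simp]: "mspace (SO_metric n) = SO n"
  unfolding SO_metric_def by (rule Metric_space.mspace_metric[OF Metric_space_SO])

lemma mdist_SO: "A \<in> SO n \<Longrightarrow> B \<in> SO n \<Longrightarrow> mdist (SO_metric n) A B = hs_norm (A - B)"
  unfolding SO_metric_def by (simp add: Metric_space.mdist_metric[OF Metric_space_SO])

lemma SO_entry_le_1:
  assumes A: "A \<in> SO n" and ij: "i < n" "j < n"
  shows "\<bar>A $$ (i, j)\<bar> \<le> 1"
proof -
  have c: "A \<in> carrier_mat n n" using A by (rule SO_carrier)
  have "(transpose_mat A * A) $$ (j, j) = 1"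
    using A ij by (simp add: SO_def)
  moreover have "(transpose_mat A * A) $$ (j, j) = (\<Sum>i<n. (A $$ (i, j))\<^sup>2)"
    using c ij by (simp add: scalar_prod_def power2_eq_square lessThan_atLeast0)
  moreover have "(A $$ (i, j))\<^sup>2 \<le> (\<Sum>i<n. (A $$ (i, j))\<^sup>2)"
    using ij by (intro member_le_sum) auto
  ultimately have "(A $$ (i, j))\<^sup>2 \<le> 1" by simp
  then show ?thesis by (simp add: abs_square_le_1)
qed

lemma finitely_many_bounded_seqs:
  fixes f :: "nat \<Rightarrow> 'p \<Rightarrow> real"
  assumes "finite P" "\<And>k p. p \<in> P \<Longrightarrow> \<bar>f k p\<bar> \<le> 1"
  shows "\<exists>r. strict_mono (r :: nat \<Rightarrow> nat) \<and> (\<forall>p\<in>P. convergent (\<lambda>k. f (r k) p))"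
  using assms
proof (induction P)
  case empty
  then show ?case by (auto intro: exI[of _ id] simp: strict_mono_id)
next
  case (insert q P)
  then obtain r :: "nat \<Rightarrow> nat" where r: "strict_mono r" "\<forall>p\<in>P. convergent (\<lambda>k. f (r k) p)"
    by auto
  have "bounded (range (\<lambda>k. f (r k) q))"
    using insert.prems by (auto simp: bounded_iff)
  then obtain l s where s: "strict_mono (s :: nat \<Rightarrow> nat)" "((\<lambda>k. f (r k) q) \<circ> s) \<longlonglongrightarrow> l"
    using bounded_imp_convergent_subsequence by blast
  have "convergent (\<lambda>k. f ((r \<circ> s) k) p)" if "p \<in> insert q P" for p
    using that s r(2) convergent_subseq_convergent[OF _ s(1), of "\<lambda>k. f (r k) p"]
    by (auto simp: convergent_def o_def)
  then show ?case
    using strict_mono_o[OF r(1) s(1)] by blast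
qed

lemma permutes_nat_less: "p permutes {0..<n} \<Longrightarrow> i < n \<Longrightarrow> p i < (n :: nat)"
  using permutes_in_image[of p "{0..<n}" i] by simp

lemma SO_closed_under_limits:
  assumes \<sigma>: "\<And>k. \<sigma> k \<in> SO n" and L: "L \<in> carrier_mat n n"
    and lim: "\<And>i j. i < n \<Longrightarrow> j < n \<Longrightarrow> (\<lambda>k. \<sigma> k $$ (i, j)) \<longlonglongrightarrow> L $$ (i, j)"
  shows "L \<in> SO n"
proof -
  have c: "\<sigma> k \<in> carrier_mat n n" for k using \<sigma> by (rule SO_carrier)
  have "(transpose_mat L * L) $$ (i, j) = 1\<^sub>m n $$ (i, j)" if "i < n" "j < n" for i j
  proof -
    have "(\<lambda>k. \<Sum>l<n. \<sigma> k $$ (l, i) * \<sigma> k $$ (l, j)) \<longlonglongrightarrow> (\<Sum>l<n. L $$ (l, i) * L $$ (l, j))"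
      using that by (intro tendsto_intros lim) auto
    moreover have "(\<Sum>l<n. \<sigma> k $$ (l, i) * \<sigma> k $$ (l, j)) = 1\<^sub>m n $$ (i, j)" for k
    proof -
      have "(transpose_mat (\<sigma> k) * \<sigma> k) $$ (i, j) = 1\<^sub>m n $$ (i, j)"
        using \<sigma>[of k] by (simp add: SO_def)
      moreover have "(transpose_mat (\<sigma> k) * \<sigma> k) $$ (i, j) = (\<Sum>l<n. \<sigma> k $$ (l, i) * \<sigma> k $$ (l, j))"
        using c[of k] that by (simp add: scalar_prod_def lessThan_atLeast0)
      ultimately show ?thesis by simp
    qed
    ultimately have "(\<Sum>l<n. L $$ (l, i) * L $$ (l, j)) = 1\<^sub>m n $$ (i, j)"
      by (simp add: LIMSEQ_const_iff)
    then show ?thesis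
      using L that by (simp add: scalar_prod_def lessThan_atLeast0)
  qed
  then have "transpose_mat L * L = 1\<^sub>m n"
    using L by (intro eq_matI) auto
  moreover have "det L = 1"
  proof -
    have "(\<lambda>k. \<Sum>p\<in>{p. p permutes {0..<n}}. signof p * (\<Prod>i=0..<n. \<sigma> k $$ (i, p i)))
        \<longlonglongrightarrow> (\<Sum>p\<in>{p. p permutes {0..<n}}. signof p * (\<Prod>i=0..<n. L $$ (i, p i)))"
      by (intro tendsto_intros lim) (auto simp: permutes_nat_less)
    then have "(\<lambda>k. det (\<sigma> k)) \<longlonglongrightarrow> det L"
      by (simp add: det_def'[OF c] det_def'[OF L])
    moreover have "det (\<sigma> k) = 1" for k using \<sigma>[of k] by (simp add: SO_def)
    ultimately show ?thesis by (simp add: LIMSEQ_const_iff)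
  qed
  ultimately show ?thesis using L by (simp add: SO_def)
qed

lemma compact_SO: "compact_space (mtopology_of (SO_metric n))"
proof -
  let ?d = "\<lambda>A B. if A \<in> SO n \<and> B \<in> SO n then hs_norm (A - B) else 0"
  interpret SO: Metric_space "SO n" ?d by (rule Metric_space_SO)
  have "\<exists>l r. l \<in> SO n \<and> strict_mono r \<and> limitin SO.mtopology (\<sigma> \<circ> r) l sequentially"
    if "range \<sigma> \<subseteq> SO n" for \<sigma> :: "nat \<Rightarrow> real mat"
  proof -
    have \<sigma>: "\<sigma> k \<in> SO n" for k using that by auto
    obtain r :: "nat \<Rightarrow> nat" where r: "strict_mono r"
      "\<forall>p\<in>{..<n} \<times> {..<n}. convergent (\<lambda>k. \<sigma> (r k) $$ p)"
      using finitely_many_bounded_seqs[of "{..<n} \<times> {..<n}" "\<lambda>k p. \<sigma> k $$ p"] SO_entry_le_1[OF \<sigma>]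
      by auto
    define L where "L = mat n n (\<lambda>p. lim (\<lambda>k. \<sigma> (r k) $$ p))"
    have Lc: "L \<in> carrier_mat n n" by (simp add: L_def)
    have lim: "(\<lambda>k. \<sigma> (r k) $$ p) \<longlonglongrightarrow> L $$ p" if "p \<in> {..<n} \<times> {..<n}" for p
      using r(2) that by (auto simp: L_def convergent_LIMSEQ_iff)
    have L: "L \<in> SO n"
      by (rule SO_closed_under_limits[of "\<sigma> \<circ> r"]) (auto simp: \<sigma> Lc lim)
    have "(\<lambda>k. L2_set (\<lambda>p. \<sigma> (r k) $$ p - L $$ p) ({..<n} \<times> {..<n})) \<longlonglongrightarrow>
        sqrt (\<Sum>p\<in>{..<n} \<times> {..<n}. (L $$ p - L $$ p)\<^sup>2)"
      unfolding L2_set_def by (intro tendsto_intros lim)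
    then have "(\<lambda>k. ?d ((\<sigma> \<circ> r) k) L) \<longlonglongrightarrow> 0"
      using \<sigma> L by (simp add: hs_dist_L2[OF SO_carrier[OF \<sigma>] Lc])
    then have "limitin SO.mtopology (\<sigma> \<circ> r) L sequentially"
      using \<sigma> L by (simp add: SO.limitin_metric_dist_null)
    then show ?thesis using L r(1) by blast
  qed
  then show ?thesis
    by (simp add: SO_metric_def SO.compact_space_sequentially)
qed

lemma (in Metric_space) mtotally_bounded_imp_separable:
  assumes "mtotally_bounded M"
  shows "separable_space mtopology"
proof -
  obtain K where K: "\<And>k :: nat. finite (K k) \<and> K k \<subseteq> M \<and> M \<subseteq> (\<Union>x\<in>K k. mball x (inverse (Suc k)))"
  proof -
    have "\<exists>K. finite K \<and> K \<subseteq> M \<and> M \<subseteq> (\<Union>x\<in>K. mball x (inverse (real (Suc k))))" for k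
      using assms by (simp add: mtotally_bounded_def)
    then show ?thesis using that by metis
  qed
  have "mtopology closure_of (\<Union>k. K k) = M"
  proof -
    have "\<exists>y\<in>\<Union>k. K k. y \<in> mball x r" if "x \<in> M" "r > 0" for x r
    proof -
      obtain k where k: "inverse (real (Suc k)) < r"
        using \<open>r > 0\<close> reals_Archimedean by blast
      obtain y where "y \<in> K k" "x \<in> mball y (inverse (Suc k))"
        using K[of k] \<open>x \<in> M\<close> by blast
      then show ?thesis using k by (force simp: commute)
    qed
    then show ?thesis by (auto simp: metric_closure_of)
  qed
  then show ?thesis
    unfolding separable_space_def
    using K by (intro exI[of _ "\<Union>k. K k"] conjI)
      (simp_all add: countable_finite UN_least)
qed

lemma mm_space_SO:
  assumes "haar_prob_SO n \<mu>"
  shows "mm_space (SO_metric n, \<mu>)"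
proof -
  interpret SO: Metric_space "SO n" "\<lambda>A B. if A \<in> SO n \<and> B \<in> SO n then hs_norm (A - B) else 0"
    by (rule Metric_space_SO)
  have "compact_space SO.mtopology"
    using compact_SO[of n] by (simp add: SO_metric_def)
  then show ?thesis
    using assms SO.mtotally_bounded_imp_separable
    by (auto simp: mm_space_def SO_metric_def haar_prob_SO_def prob_space.finite_measure
        SO.compact_space_eq_mcomplete_mtotally_bounded)
qed

end

theory Submission
  imports Defs
begin

text \<open>
  For \<open>A, B \<in> SO(n)\<close> one has \<open>d\<^sub>n(A, B)\<^sup>2 = 2n - 2 tr(A\<^sup>T B)\<close>. If \<open>B\<close> is Haar distributed, so is
  \<open>A\<^sup>T B\<close>, and the trace of a Haar distributed matrix has second moment at most 4 for every \<open>n\<close>: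
  row sign flips make the diagonal entries uncorrelated and signed row swaps give each of them
  second moment \<open>1/n\<close>. By Markov's inequality \<open>d\<^sub>n\<^sup>2\<close> is within 10 of \<open>2n\<close> with probability at least 21/25.
  Hence if \<open>\<epsilon> < 1/2\<close> is admissible for two parameters, any point of \<open>T\<close> has a partner
  in \<open>T\<close> for which \<open>\<bar>d\<^sub>n\<^sup>2 - d\<^sub>m\<^sup>2\<bar> \<ge> 2\<bar>n - m\<bar> - 20\<close>, while
  \<open>\<bar>d\<^sub>n\<^sup>2 - d\<^sub>m\<^sup>2\<bar> \<le> \<epsilon> (d\<^sub>n + d\<^sub>m) \<le> \<epsilon> (\<surd>(2n + 10) + \<surd>(2m + 10))\<close>.
  With \<open>\<bar>n - m\<bar>\<close> of order \<open>\<surd>k\<close> the constants 20 and 10 are negligible.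
\<close>

section \<open>Algebra of the trace and of the special orthogonal group\<close>

lemma mat_trace_transpose_mult:
  assumes "A \<in> carrier_mat n n" "B \<in> carrier_mat n n"
  shows "mat_trace (transpose_mat A * B) = (\<Sum>j<n. \<Sum>i<n. A $$ (i, j) * B $$ (i, j))"
  using assms by (auto simp: mat_trace_def scalar_prod_def lessThan_atLeast0 intro!: sum.cong)

lemma hs_norm_nonneg: "A \<in> carrier_mat n n \<Longrightarrow> 0 \<le> hs_norm A"
  by (simp add: hs_norm_L2)

lemma hs_norm_power2:
  assumes "A \<in> carrier_mat n n"
  shows "(hs_norm A)\<^sup>2 = mat_trace (transpose_mat A * A)"
proof -
  have "0 \<le> mat_trace (transpose_mat A * A)"
    unfolding mat_trace_transpose_mult[OF assms assms] by (intro sum_nonneg) auto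
  then show ?thesis by (simp add: hs_norm_def)
qed

lemma entry_le_hs_norm:
  assumes "A \<in> carrier_mat n n" "i < n" "j < n"
  shows "\<bar>A $$ (i, j)\<bar> \<le> hs_norm A"
proof -
  have "\<bar>A $$ (i, j)\<bar> \<le> L2_set (\<lambda>p. \<bar>A $$ p\<bar>) ({..<n} \<times> {..<n})"
    using assms by (intro member_le_L2_set) auto
  then show ?thesis
    using assms by (simp add: hs_norm_L2 L2_set_def case_prod_unfold)
qed

lemma mat_trace_one: "mat_trace (1\<^sub>m n) = real n"
  by (simp add: mat_trace_def)

text \<open>The columns of both matrices are unit vectors, so each squared norm equals
  \<open>n\<close> and only the cross term varies. Metric questions thereby become questions about
  traces.\<close>

lemma hs_dist_SO_power2:
  assumes A: "A \<in> SO n" and B: "B \<in> SO n"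
  shows "(hs_norm (A - B))\<^sup>2 = 2 * real n - 2 * mat_trace (transpose_mat A * B)"
proof -
  have c: "A \<in> carrier_mat n n" "B \<in> carrier_mat n n" using A B by (auto intro: SO_carrier)
  then have c': "A - B \<in> carrier_mat n n" by (simp add: minus_carrier_mat)
  have "(\<Sum>j<n. \<Sum>i<n. A $$ (i, j) * A $$ (i, j)) = real n"
    using A by (simp add: mat_trace_transpose_mult[OF c(1) c(1), symmetric] SO_def mat_trace_one)
  moreover have "(\<Sum>j<n. \<Sum>i<n. B $$ (i, j) * B $$ (i, j)) = real n"
    using B by (simp add: mat_trace_transpose_mult[OF c(2) c(2), symmetric] SO_def mat_trace_one)
  moreover have "(hs_norm (A - B))\<^sup>2 = (\<Sum>j<n. \<Sum>i<n. (A $$ (i, j) - B $$ (i, j)) * (A $$ (i, j) - B $$ (i, j)))"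
    using c unfolding hs_norm_power2[OF c'] mat_trace_transpose_mult[OF c' c'] 
    by (intro sum.cong) auto
  ultimately show ?thesis
    unfolding mat_trace_transpose_mult[OF c]
    by (simp add: algebra_simps sum.distrib sum_subtractf sum_distrib_left)
qed

lemma orthogonal_mult:
  fixes A B :: "real mat"
  assumes "A \<in> carrier_mat n n" "B \<in> carrier_mat n n"
    and "transpose_mat A * A = 1\<^sub>m n" "transpose_mat B * B = 1\<^sub>m n"
  shows "transpose_mat (A * B) * (A * B) = 1\<^sub>m n"
proof -
  have "transpose_mat (A * B) * (A * B) = transpose_mat B * (transpose_mat A * A) * B"
    using assms(1,2) by (simp add: transpose_mult[OF assms(1,2)] assoc_mult_mat[of _ n n _ n _ n])
  then show ?thesis using assms by simp
qed

lemma SO_mult: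
  assumes A: "A \<in> SO n" and B: "B \<in> SO n"
  shows "A * B \<in> SO n"
proof -
  have c: "A \<in> carrier_mat n n" "B \<in> carrier_mat n n" using A B by (auto intro: SO_carrier)
  then show ?thesis
    using A B mult_carrier_mat[OF c] orthogonal_mult[OF c] det_mult[OF c] by (simp add: SO_def)
qed

text \<open>For square matrices a left inverse is also a right inverse.\<close>

lemma SO_transpose:
  assumes A: "A \<in> SO n"
  shows "transpose_mat A \<in> SO n"
proof -
  have c: "A \<in> carrier_mat n n" using A by (rule SO_carrier)
  then have "A * transpose_mat A = 1\<^sub>m n"
    using A by (intro mat_mult_left_right_inverse[of "transpose_mat A" n A]) (auto simp: SO_def)
  then show ?thesis
    using c A by (simp add: SO_def det_transpose[OF c])
qed

lemma hs_norm_SO_mult_left: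
  assumes A: "A \<in> SO n" and B: "B \<in> carrier_mat n n"
  shows "hs_norm (A * B) = hs_norm B"
proof -
  have c: "A \<in> carrier_mat n n" using A by (rule SO_carrier)
  have "transpose_mat (A * B) * (A * B) = transpose_mat B * (transpose_mat A * A) * B"
    using c B by (simp add: transpose_mult[OF c B] assoc_mult_mat[of _ n n _ n _ n])
  then show ?thesis
    using A B by (simp add: hs_norm_def SO_def)
qed

lemma hs_dist_SO_mult_left:
  assumes A: "A \<in> SO n" and B: "B \<in> SO n" and C: "C \<in> SO n"
  shows "hs_norm (A * B - A * C) = hs_norm (B - C)"
proof -
  have c: "A \<in> carrier_mat n n" "B \<in> carrier_mat n n" "C \<in> carrier_mat n n"
    using A B C by (auto intro: SO_carrier)
  then have "A * B - A * C = A * (B - C)" by (simp add: mult_minus_distrib_mat)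
  then show ?thesis
    using hs_norm_SO_mult_left[OF A] c by (simp add: minus_carrier_mat)
qed

lemma mat_trace_SO_le:
  assumes "B \<in> SO n"
  shows "\<bar>mat_trace B\<bar> \<le> real n"
proof -
  have "\<bar>mat_trace B\<bar> \<le> (\<Sum>i<n. \<bar>B $$ (i, i)\<bar>)"
    using SO_carrier[OF assms] by (auto simp: mat_trace_def intro: sum_abs)
  also have "\<dots> \<le> (\<Sum>i<n. 1)"
    using assms by (intro sum_mono SO_entry_le_1) auto
  finally show ?thesis by simp
qed


section \<open>Measurability\<close>

text \<open>An epsilon-delta form of openness stated with \<open>hs_norm\<close> itself, free of the
  case distinction built into \<open>SO_metric\<close>.\<close>

lemma openin_SO:
  "openin (mtopology_of (SO_metric n)) U \<longleftrightarrow>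
    U \<subseteq> SO n \<and> (\<forall>A\<in>U. \<exists>r>0. \<forall>B\<in>SO n. hs_norm (A - B) < r \<longrightarrow> B \<in> U)"
proof -
  interpret SO: Metric_space "SO n" "\<lambda>A B. if A \<in> SO n \<and> B \<in> SO n then hs_norm (A - B) else 0"
    by (rule Metric_space_SO)
  have "mtopology_of (SO_metric n) = SO.mtopology"
    by (simp add: SO_metric_def)
  moreover have "SO.mball A r \<subseteq> U \<longleftrightarrow> (\<forall>B\<in>SO n. hs_norm (A - B) < r \<longrightarrow> B \<in> U)" if "A \<in> SO n" for A r
    using that by (auto simp: SO.mball_def)
  ultimately show ?thesis
    by (simp add: SO.openin_mtopology) (meson subsetD)
qed

lemma space_borel_SO [simp]: "space (borel_of_metric (SO_metric n)) = SO n"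
  by (simp add: borel_of_metric_def space_measure_of_conv)

lemma openin_SO_sets:
  assumes "openin (mtopology_of (SO_metric n)) U"
  shows "U \<in> sets (borel_of_metric (SO_metric n))"
proof -
  have "{U. openin (mtopology_of (SO_metric n)) U} \<subseteq> Pow (SO n)"
    by (auto simp: openin_SO)
  then show ?thesis
    using assms by (simp add: borel_of_metric_def)
qed

text \<open>Each entry is a 1-Lipschitz function of the matrix, hence continuous.\<close>

lemma measurable_SO_entry:
  assumes "i < n" "j < n"
  shows "(\<lambda>A. A $$ (i, j)) \<in> borel_measurable (borel_of_metric (SO_metric n))"
proof (rule borel_measurableI)
  fix S :: "real set" assume "open S"
  have "openin (mtopology_of (SO_metric n)) ((\<lambda>A. A $$ (i, j)) -` S \<inter> SO n)"
    unfolding openin_SO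
  proof (intro conjI ballI)
    fix A assume A: "A \<in> (\<lambda>A. A $$ (i, j)) -` S \<inter> SO n"
    then obtain r where r: "r > 0" "\<And>y. dist y (A $$ (i, j)) < r \<Longrightarrow> y \<in> S"
      using \<open>open S\<close> by (auto simp: open_dist)
    have "B $$ (i, j) \<in> S" if B: "B \<in> SO n" "hs_norm (A - B) < r" for B
    proof (rule r(2))
      have c: "A \<in> carrier_mat n n" "B \<in> carrier_mat n n"
        using A B by (auto intro: SO_carrier)
      then have "\<bar>(A - B) $$ (i, j)\<bar> \<le> hs_norm (A - B)"
        using assms by (intro entry_le_hs_norm[of _ n]) (auto simp: minus_carrier_mat)
      then show "dist (B $$ (i, j)) (A $$ (i, j)) < r"
        using that c assms by (simp add: dist_real_def)
    qed
    then show "\<exists>r>0. \<forall>B\<in>SO n. hs_norm (A - B) < r \<longrightarrow> B \<in> (\<lambda>A. A $$ (i, j)) -` S \<inter> SO n"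
      using r(1) by auto
  qed auto
  then show "(\<lambda>A. A $$ (i, j)) -` S \<inter> space (borel_of_metric (SO_metric n)) \<in> sets (borel_of_metric (SO_metric n))"
    by (simp add: openin_SO_sets)
qed

text \<open>Left translation is an isometry, so a radius that works at \<open>A * B\<close> also
  works at \<open>B\<close>.\<close>

lemma measurable_SO_mult_left:
  assumes A: "A \<in> SO n"
  shows "(\<lambda>B. A * B) \<in> measurable (borel_of_metric (SO_metric n)) (borel_of_metric (SO_metric n))"
\<comment> \<open>Only the target sigma-algebra is unfolded, so that open sets suffice as test
  sets.\<close>
proof (subst (2) borel_of_metric_def, rule measurable_measure_of)
  fix U assume "U \<in> {U. openin (mtopology_of (SO_metric n)) U}"
  then have U: "U \<subseteq> SO n" "\<And>A. A \<in> U \<Longrightarrow> \<exists>r>0. \<forall>B\<in>SO n. hs_norm (A - B) < r \<longrightarrow> B \<in> U"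
    by (auto simp: openin_SO)
  have "openin (mtopology_of (SO_metric n)) ((\<lambda>B. A * B) -` U \<inter> SO n)"
    unfolding openin_SO
  proof (intro conjI ballI)
    fix B assume B: "B \<in> (\<lambda>B. A * B) -` U \<inter> SO n"
    then obtain r where "r > 0" "\<And>C. C \<in> SO n \<Longrightarrow> hs_norm (A * B - C) < r \<Longrightarrow> C \<in> U"
      using U(2)[of "A * B"] by auto
    then show "\<exists>r>0. \<forall>C\<in>SO n. hs_norm (B - C) < r \<longrightarrow> C \<in> (\<lambda>B. A * B) -` U \<inter> SO n"
      using A B by (intro exI[of _ r]) (auto simp: SO_mult hs_dist_SO_mult_left)
  qed auto
  then show "(\<lambda>B. A * B) -` U \<inter> space (borel_of_metric (SO_metric n)) \<in> sets (borel_of_metric (SO_metric n))"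
    by (simp add: openin_SO_sets)
qed (use A in \<open>auto simp: openin_SO SO_mult\<close>)

lemma measurable_mat_trace_SO:
  assumes A: "A \<in> SO n"
  shows "(\<lambda>B. mat_trace (transpose_mat A * B)) \<in> borel_measurable (borel_of_metric (SO_metric n))"
proof -
  have "(\<lambda>B. \<Sum>j<n. \<Sum>i<n. A $$ (i, j) * B $$ (i, j)) \<in> borel_measurable (borel_of_metric (SO_metric n))"
    by (intro borel_measurable_sum borel_measurable_times borel_measurable_const measurable_SO_entry) auto
  then show ?thesis
    by (rule measurable_cong[THEN iffD1, rotated]) (simp add: mat_trace_transpose_mult[OF SO_carrier[OF A] SO_carrier])
qed


section \<open>The second moment of the trace\<close>

lemma transpose_multrow_mat [simp]: "transpose_mat (multrow_mat n k a) = multrow_mat n k a"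
  by (rule eq_matI) auto

lemma transpose_swaprows_mat [simp]: "transpose_mat (swaprows_mat n k l) = swaprows_mat n k l"
  by (rule eq_matI) auto

lemma multrow_mat_orthogonal:
  "transpose_mat (multrow_mat n k (-1 :: real)) * multrow_mat n k (-1) = 1\<^sub>m n"
  by (subst transpose_multrow_mat, subst multrow_mat[OF multrow_mat_carrier, symmetric], rule eq_matI)
     (auto simp: mat_multrow_def)

lemma swaprows_mat_orthogonal:
  "k < n \<Longrightarrow> l < n \<Longrightarrow> transpose_mat (swaprows_mat n k l :: real mat) * swaprows_mat n k l = 1\<^sub>m n"
  by (simp add: swaprows_mat_inv)

text \<open>A single sign flip or row swap has determinant -1 and lies outside the group; the
  invariance arguments below therefore use products of two of them.\<close>

lemma orthogonal_mult_in_SO: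
  assumes "A \<in> carrier_mat n n" "B \<in> carrier_mat n n"
    and "transpose_mat A * A = 1\<^sub>m n" "transpose_mat B * B = 1\<^sub>m n"
    and "det A = -1" "det B = -1"
  shows "A * B \<in> SO n"
  unfolding SO_def
  using orthogonal_mult[OF assms(1-4)] assms(5,6) mult_carrier_mat[OF assms(1,2)] det_mult[OF assms(1,2)]
  by simp

lemma flip_in_SO:
  assumes "i < n" "j < n"
  shows "multrow_mat n i (-1) * multrow_mat n j (-1) \<in> SO n"
  by (intro orthogonal_mult_in_SO multrow_mat_carrier multrow_mat_orthogonal det_multrow_mat assms)

lemma quarter_turn_in_SO:
  assumes "i < n" "j < n" "i \<noteq> j"
  shows "multrow_mat n i (-1) * swaprows_mat n i j \<in> SO n"
  by (intro orthogonal_mult_in_SO multrow_mat_carrier swaprows_mat_carrier multrow_mat_orthogonal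
      swaprows_mat_orthogonal det_multrow_mat det_swaprows_mat assms)

text \<open>The invariance built into \<open>haar_prob_SO\<close> is under left multiplication, so
  every symmetry exploited here is a row operation.\<close>

locale haar_SO =
  fixes n :: nat and \<mu> :: "real mat measure"
  assumes haar: "haar_prob_SO n \<mu>"
begin

sublocale prob_space \<mu>
  using haar by (simp add: haar_prob_SO_def)

lemma sets_haar [measurable_cong]: "sets \<mu> = sets (borel_of_metric (SO_metric n))"
  using haar by (simp add: haar_prob_SO_def)

lemma space_haar: "space \<mu> = SO n"
  using sets_eq_imp_space_eq[OF sets_haar] by simp

lemma measurable_haar: "measurable \<mu> N = measurable (borel_of_metric (SO_metric n)) N"
  by (rule measurable_cong_sets[OF sets_haar refl])

lemma measurable_entry: "i < n \<Longrightarrow> j < n \<Longrightarrow> (\<lambda>A. A $$ (i, j)) \<in> borel_measurable \<mu>"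
  by (simp add: measurable_haar measurable_SO_entry)

lemma integral_mult_left:
  fixes f :: "real mat \<Rightarrow> real"
  assumes A: "A \<in> SO n" and f: "f \<in> borel_measurable \<mu>"
  shows "(\<integral>B. f (A * B) \<partial>\<mu>) = (\<integral>B. f B \<partial>\<mu>)"
proof -
  have m: "(\<lambda>B. A * B) \<in> measurable \<mu> \<mu>"
    using measurable_SO_mult_left[OF A]
    by (simp cong: measurable_cong_sets add: sets_haar)
  have "(\<integral>B. f B \<partial>\<mu>) = (\<integral>B. f B \<partial>distr \<mu> \<mu> (\<lambda>B. A * B))"
    using haar A by (simp add: haar_prob_SO_def)
  also have "\<dots> = (\<integral>B. f (A * B) \<partial>\<mu>)"
    by (rule integral_distr[OF m f])
  finally show ?thesis by simp
qed

lemma measurable_diag_mult: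
  "i < n \<Longrightarrow> j < n \<Longrightarrow> (\<lambda>B. B $$ (i, i) * B $$ (j, j)) \<in> borel_measurable \<mu>"
  by (intro borel_measurable_times measurable_entry)

lemma integrable_diag_mult:
  assumes "i < n" "j < n"
  shows "integrable \<mu> (\<lambda>B. B $$ (i, i) * B $$ (j, j))"
proof (rule integrable_const_bound[where B = 1])
  show "AE B in \<mu>. norm (B $$ (i, i) * B $$ (j, j)) \<le> 1"
    using assms by (intro AE_I2) (simp add: space_haar abs_mult mult_le_one SO_entry_le_1[where n = n])
qed (rule measurable_diag_mult[OF assms])

lemma integrable_entry_power2:
  assumes "i < n" "j < n"
  shows "integrable \<mu> (\<lambda>B. (B $$ (i, j))\<^sup>2)"
proof (rule integrable_const_bound[where B = 1])
  show "AE B in \<mu>. norm ((B $$ (i, j))\<^sup>2) \<le> 1"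
    using assms by (intro AE_I2) (simp add: space_haar abs_square_le_1 SO_entry_le_1[where n = n])
qed (intro borel_measurable_power measurable_entry assms)

text \<open>Flipping the signs of row \<open>i\<close> and of a third row \<open>k\<close> is a
  rotation that negates the product of the two diagonal entries, so the integral equals its own
  negative. The third row is where \<open>n \<ge> 3\<close> enters; in SO(2) the two diagonal
  entries coincide.\<close>

lemma diag_uncorrelated:
  assumes "i < n" "j < n" "i \<noteq> j" "n \<ge> 3"
  shows "(\<integral>B. B $$ (i, i) * B $$ (j, j) \<partial>\<mu>) = 0"
proof -
  have "card {i, j} < card {..<n}" using assms by auto
  then have "\<not> {..<n} \<subseteq> {i, j}"
    by (meson card_mono finite.emptyI finite.insertI not_le)
  then obtain k where k: "k < n" "k \<noteq> i" "k \<noteq> j" by auto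
  let ?D = "multrow_mat n i (-1) * multrow_mat n k (-1) :: real mat"
  have "(\<integral>B. B $$ (i, i) * B $$ (j, j) \<partial>\<mu>) = (\<integral>B. (?D * B) $$ (i, i) * (?D * B) $$ (j, j) \<partial>\<mu>)"
    using assms k by (intro integral_mult_left[symmetric] flip_in_SO measurable_diag_mult) auto
  also have "\<dots> = (\<integral>B. - (B $$ (i, i) * B $$ (j, j)) \<partial>\<mu>)"
  proof (rule Bochner_Integration.integral_cong[OF refl])
    fix B assume "B \<in> space \<mu>"
    then have c: "B \<in> carrier_mat n n" by (auto simp: space_haar intro: SO_carrier)
    have "?D * B = multrow i (-1) (multrow k (-1) B)"
      using c multrow_mat[OF c] multrow_mat[OF mult_carrier_mat[OF multrow_mat_carrier c]]
      by (simp add: assoc_mult_mat[of _ n n _ n _ n])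
    then show "(?D * B) $$ (i, i) * (?D * B) $$ (j, j) = - (B $$ (i, i) * B $$ (j, j))"
      using c assms k by (simp add: mat_multrow_def)
  qed
  finally show ?thesis by simp
qed

text \<open>A row swap needs a sign flip to become a rotation; squaring the entry removes that
  sign.\<close>

lemma integral_entry_power2_row:
  assumes "i < n" "j < n" "k < n"
  shows "(\<integral>B. (B $$ (i, j))\<^sup>2 \<partial>\<mu>) = (\<integral>B. (B $$ (k, j))\<^sup>2 \<partial>\<mu>)"
proof (cases "i = k")
  case False
  let ?R = "multrow_mat n i (-1) * swaprows_mat n i k :: real mat"
  have "(\<integral>B. (B $$ (i, j))\<^sup>2 \<partial>\<mu>) = (\<integral>B. ((?R * B) $$ (i, j))\<^sup>2 \<partial>\<mu>)"
    using assms False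
    by (intro integral_mult_left[symmetric] quarter_turn_in_SO borel_measurable_power measurable_entry)
  also have "\<dots> = (\<integral>B. (B $$ (k, j))\<^sup>2 \<partial>\<mu>)"
  proof (rule Bochner_Integration.integral_cong[OF refl])
    fix B assume "B \<in> space \<mu>"
    then have c: "B \<in> carrier_mat n n" by (auto simp: space_haar intro: SO_carrier)
    have "?R * B = multrow i (-1) (swaprows i k B)"
      using c swaprows_mat[OF c assms(1,3)] multrow_mat[OF mult_carrier_mat[OF swaprows_mat_carrier c]]
      by (simp add: assoc_mult_mat[of _ n n _ n _ n])
    then show "((?R * B) $$ (i, j))\<^sup>2 = (B $$ (k, j))\<^sup>2"
      using c assms False by (simp add: mat_multrow_def mat_swaprows_def)
  qed
  finally show ?thesis .
qed simp

text \<open>The \<open>n\<close> entries of a column have equal second moments, and their squares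
  add up to 1 because the column is a unit vector.\<close>

lemma integral_entry_power2:
  assumes ij: "i < n" "j < n"
  shows "(\<integral>B. (B $$ (i, j))\<^sup>2 \<partial>\<mu>) = 1 / real n"
proof -
  have "real n * (\<integral>B. (B $$ (i, j))\<^sup>2 \<partial>\<mu>) = (\<Sum>k<n. \<integral>B. (B $$ (i, j))\<^sup>2 \<partial>\<mu>)"
    by simp
  also have "\<dots> = (\<Sum>k<n. \<integral>B. (B $$ (k, j))\<^sup>2 \<partial>\<mu>)"
    by (intro sum.cong integral_entry_power2_row ij) auto
  also have "\<dots> = (\<integral>B. (\<Sum>k<n. (B $$ (k, j))\<^sup>2) \<partial>\<mu>)"
    using ij by (intro Bochner_Integration.integral_sum[symmetric] integrable_entry_power2) auto
  also have "\<dots> = (\<integral>B. 1 \<partial>\<mu>)"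
  proof (rule Bochner_Integration.integral_cong[OF refl])
    fix B assume "B \<in> space \<mu>"
    then have B: "B \<in> SO n" by (simp add: space_haar)
    have "(transpose_mat B * B) $$ (j, j) = 1"
      using B ij by (simp add: SO_def)
    then show "(\<Sum>k<n. (B $$ (k, j))\<^sup>2) = 1"
      using SO_carrier[OF B] ij by (simp add: scalar_prod_def power2_eq_square lessThan_atLeast0)
  qed
  also have "\<dots> = 1" by (simp add: prob_space)
  finally show ?thesis using ij by (simp add: field_simps)
qed

lemma mat_trace_power2: "B \<in> SO n \<Longrightarrow> (mat_trace B)\<^sup>2 = (\<Sum>i<n. \<Sum>j<n. B $$ (i, i) * B $$ (j, j))"
  by (auto dest!: SO_carrier simp: mat_trace_def power2_eq_square sum_product)

lemma measurable_mat_trace: "mat_trace \<in> borel_measurable \<mu>"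
proof -
  have "(\<lambda>B. \<Sum>i<n. B $$ (i, i)) \<in> borel_measurable \<mu>"
    by (intro borel_measurable_sum measurable_entry) auto
  then show ?thesis
    by (rule measurable_cong[THEN iffD1, rotated]) (auto simp: space_haar mat_trace_def dest: SO_carrier)
qed

lemma integrable_mat_trace_power2: "integrable \<mu> (\<lambda>B. (mat_trace B)\<^sup>2)"
proof -
  have "integrable \<mu> (\<lambda>B. \<Sum>i<n. \<Sum>j<n. B $$ (i, i) * B $$ (j, j))"
    by (intro Bochner_Integration.integrable_sum integrable_diag_mult) auto
  then show ?thesis
    by (rule Bochner_Integration.integrable_cong[THEN iffD1, rotated 2]) (auto simp: space_haar mat_trace_power2)
qed

text \<open>For \<open>n \<ge> 3\<close> the second moment is exactly 1; for \<open>n \<le> 2\<close> only \<open>\<bar>mat_trace B\<bar> \<le> n\<close> is used.\<close>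

lemma mat_trace_second_moment: "(\<integral>B. (mat_trace B)\<^sup>2 \<partial>\<mu>) \<le> 4"
proof (cases "n \<ge> 3")
  case True
  have "(\<integral>B. (mat_trace B)\<^sup>2 \<partial>\<mu>) = (\<integral>B. (\<Sum>i<n. \<Sum>j<n. B $$ (i, i) * B $$ (j, j)) \<partial>\<mu>)"
    by (rule Bochner_Integration.integral_cong) (auto simp: space_haar mat_trace_power2)
  also have "\<dots> = (\<Sum>i<n. \<Sum>j<n. \<integral>B. B $$ (i, i) * B $$ (j, j) \<partial>\<mu>)"
    by (subst Bochner_Integration.integral_sum;
        auto intro!: Bochner_Integration.integrable_sum integrable_diag_mult
          Bochner_Integration.integral_sum sum.cong)
  also have "\<dots> = (\<Sum>i<n. \<Sum>j<n. if i = j then 1 / real n else 0)"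
    using True by (intro sum.cong refl)
      (auto simp: diag_uncorrelated integral_entry_power2 simp flip: power2_eq_square)
  also have "\<dots> = 1" using True by simp
  finally show ?thesis by simp
next
  case False
  have "(\<integral>B. (mat_trace B)\<^sup>2 \<partial>\<mu>) \<le> (\<integral>B. 4 \<partial>\<mu>)"
  proof (rule integral_mono[OF integrable_mat_trace_power2])
    fix B assume "B \<in> space \<mu>"
    then have B: "B \<in> SO n" by (simp add: space_haar)
    have "\<bar>mat_trace B\<bar> \<le> 2" using mat_trace_SO_le[OF B] False by simp
    then have "\<bar>mat_trace B\<bar>\<^sup>2 \<le> 2\<^sup>2" by (intro power_mono) auto
    then show "(mat_trace B)\<^sup>2 \<le> 4" by simp
  qed simp
  then show ?thesis by (simp add: prob_space)
qed

text \<open>Markov's inequality for the squared trace at level 25; left invariance removes the fixed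
  matrix \<open>A\<close>. The threshold 5 is large enough that two such exceptional sets have total
  measure at most 8/25, below 1/2.\<close>

lemma large_mat_trace_measure:
  assumes A: "A \<in> SO n"
  shows "measure \<mu> {B \<in> SO n. 5 \<le> \<bar>mat_trace (transpose_mat A * B)\<bar>} \<le> 4 / 25"
proof -
  let ?f = "\<lambda>B. (mat_trace (transpose_mat A * B))\<^sup>2"
  have m: "?f \<in> borel_measurable \<mu>"
    unfolding measurable_haar by (intro borel_measurable_power measurable_mat_trace_SO A)
  have i: "integrable \<mu> ?f"
  proof (rule integrable_const_bound[where B = "(real n)\<^sup>2"])
    show "AE B in \<mu>. norm (?f B) \<le> (real n)\<^sup>2"
    proof (intro AE_I2)
      fix B assume "B \<in> space \<mu>"
      then have B: "transpose_mat A * B \<in> SO n" by (simp add: space_haar SO_mult SO_transpose A)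
      show "norm (?f B) \<le> (real n)\<^sup>2"
        using mat_trace_SO_le[OF B] by (simp add: abs_le_square_iff[symmetric])
    qed
  qed (rule m)
  have "measure \<mu> {B \<in> space \<mu>. 25 \<le> ?f B} \<le> (\<integral>B. ?f B \<partial>\<mu>) / 25"
    by (rule integral_Markov_inequality_measure[OF i, where A = "{}"]) auto
  also have "(\<integral>B. ?f B \<partial>\<mu>) = (\<integral>B. (mat_trace B)\<^sup>2 \<partial>\<mu>)"
    by (intro integral_mult_left[where f = "\<lambda>B. (mat_trace B)\<^sup>2"] SO_transpose A borel_measurable_power measurable_mat_trace)
  also have "\<dots> / 25 \<le> 4 / 25" using mat_trace_second_moment by simp
  also have "{B \<in> space \<mu>. 25 \<le> ?f B} = {B \<in> SO n. 5 \<le> \<bar>mat_trace (transpose_mat A * B)\<bar>}"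
    using abs_le_square_iff[of 5] by (auto simp: space_haar)
  finally show ?thesis .
qed

end

section \<open>Lower bound for the box distance\<close>

text \<open>Bridges two conventions: parameters refer to Borel sets of the unit interval, whereas
  \<open>box1\<close> measures \<open>T\<close> by completed Lebesgue measure.\<close>

lemma sets_unit_lebesgue:
  assumes "B \<in> sets unit_lebesgue"
  shows "B \<in> lmeasurable" "measure lebesgue B = measure unit_lebesgue B"
proof -
  have B: "B \<in> sets lborel" "B \<subseteq> {0..1}"
    using assms by (auto simp: sets_restrict_space_iff)
  show "B \<in> lmeasurable"
    by (rule fmeasurableI2[of "{0..1}"]) (use B in \<open>auto intro: sets_completionI_sets\<close>)
  show "measure lebesgue B = measure unit_lebesgue B"
    using B by (simp add: measure_restrict_space)
qed

lemma parameter_in_SO: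
  "\<phi> \<in> parameters (SO_metric n, \<mu>) \<Longrightarrow> t \<in> {0..1} \<Longrightarrow> \<phi> t \<in> SO n"
  by (auto simp: parameters_def dest!: measurable_space)

text \<open>By left invariance, \<open>A\<^sup>T \<phi>(t)\<close> is Haar distributed for every fixed \<open>A\<close>; so no integration over
  the square is needed, only over \<open>t\<close> with the other point fixed.\<close>

lemma parameter_large_mat_trace:
  assumes "haar_prob_SO n \<mu>" and \<phi>: "\<phi> \<in> parameters (SO_metric n, \<mu>)" and A: "A \<in> SO n"
  defines "B \<equiv> {t \<in> {0..1}. 5 \<le> \<bar>mat_trace (transpose_mat A * \<phi> t)\<bar>}"
  shows "B \<in> lmeasurable" "measure lebesgue B \<le> 4 / 25"
proof -
  interpret haar_SO n \<mu> by standard fact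
  let ?M = "borel_of_metric (SO_metric n)"
  let ?S = "{B \<in> SO n. 5 \<le> \<bar>mat_trace (transpose_mat A * B)\<bar>}"
  have m: "\<phi> \<in> measurable unit_lebesgue ?M" and d: "distr unit_lebesgue ?M \<phi> = \<mu>"
    using \<phi> by (auto simp: parameters_def)
  have "{B \<in> space ?M. 5 \<le> \<bar>mat_trace (transpose_mat A * B)\<bar>} \<in> sets ?M"
    by (intro borel_measurable_le borel_measurable_const borel_measurable_abs measurable_mat_trace_SO A)
  then have S: "?S \<in> sets ?M" by simp
  have B: "B = \<phi> -` ?S \<inter> space unit_lebesgue"
    using parameter_in_SO[OF \<phi>] by (auto simp: B_def space_restrict_space)
  then have B': "B \<in> sets unit_lebesgue"
    using measurable_sets[OF m S] by simp
  then show "B \<in> lmeasurable" by (rule sets_unit_lebesgue)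
  have "measure lebesgue B = measure \<mu> ?S"
    using sets_unit_lebesgue(2)[OF B'] measure_distr[OF m S] by (simp only: d B)
  then show "measure lebesgue B \<le> 4 / 25"
    using large_mat_trace_measure[OF A] by simp
qed

text \<open>A typical pair of points has squared distances close to \<open>2 * n\<close> and
  \<open>2 * m\<close>. Since \<open>T\<close> has measure above 1/2, it contains a pair that is
  typical for both groups at once, and there the two distances differ by at most \<epsilon>.\<close>

lemma box_admissible_SO:
  assumes haar: "haar_prob_SO n \<mu>" "haar_prob_SO m \<nu>"
    and \<phi>: "\<phi> \<in> parameters (SO_metric n, \<mu>)" and \<psi>: "\<psi> \<in> parameters (SO_metric m, \<nu>)"
    and T: "T \<in> sets lebesgue" "T \<subseteq> {0..1}" "1 - \<epsilon> \<le> measure lebesgue T"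
    and \<epsilon>: "0 < \<epsilon>" "\<epsilon> < 1 / 2"
    and le: "\<And>s t. s \<in> T \<Longrightarrow> t \<in> T \<Longrightarrow>
      \<bar>mdist (SO_metric n) (\<phi> s) (\<phi> t) - mdist (SO_metric m) (\<psi> s) (\<psi> t)\<bar> \<le> \<epsilon>"
  shows "2 * \<bar>real n - real m\<bar> - 20 \<le> \<epsilon> * (sqrt (2 * real n + 10) + sqrt (2 * real m + 10))"
proof -
  have "T \<noteq> {}" using T(3) \<epsilon> by auto
  then obtain s where s: "s \<in> T" by auto
  have in_SO: "\<phi> t \<in> SO n" "\<psi> t \<in> SO m" if "t \<in> T" for t
    using that T(2) parameter_in_SO[OF \<phi>, of t] parameter_in_SO[OF \<psi>, of t] by auto
  let ?u = "\<lambda>t. mat_trace (transpose_mat (\<phi> s) * \<phi> t)"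
  let ?v = "\<lambda>t. mat_trace (transpose_mat (\<psi> s) * \<psi> t)"
  let ?B = "{t \<in> {0..1}. 5 \<le> \<bar>?u t\<bar>} \<union> {t \<in> {0..1}. 5 \<le> \<bar>?v t\<bar>}"
  note B1 = parameter_large_mat_trace[OF haar(1) \<phi> in_SO(1)[OF s]]
  note B2 = parameter_large_mat_trace[OF haar(2) \<psi> in_SO(2)[OF s]]
  have "measure lebesgue ?B \<le> 4 / 25 + 4 / 25"
    using measure_Un_le[OF fmeasurableD[OF B1(1)] fmeasurableD[OF B2(1)]] B1(2) B2(2) by linarith
  \<comment> \<open>The bad set has measure at most 8/25 < 1/2 < 1 - \<epsilon>.\<close>
  then have "measure lebesgue ?B < measure lebesgue T" using T(3) \<epsilon> by linarith
  moreover have "measure lebesgue T \<le> measure lebesgue ?B" if "T \<subseteq> ?B"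
    using that T(1) by (rule measure_mono_fmeasurable) (intro fmeasurable.Un B1(1) B2(1))
  ultimately have "\<not> T \<subseteq> ?B" by linarith
  then obtain t where t: "t \<in> T" "t \<notin> ?B" by blast
  then have t': "\<bar>?u t\<bar> < 5" "\<bar>?v t\<bar> < 5"
    using T(2) by (simp_all add: subset_iff)
  define a where "a = hs_norm (\<phi> s - \<phi> t)"
  define b where "b = hs_norm (\<psi> s - \<psi> t)"
  have a2: "a\<^sup>2 = 2 * real n - 2 * ?u t" and b2: "b\<^sup>2 = 2 * real m - 2 * ?v t"
    unfolding a_def b_def by (intro hs_dist_SO_power2 in_SO s t(1))+
  have ab: "0 \<le> a" "0 \<le> b"
    unfolding a_def b_def using in_SO s t(1)
    by (auto intro!: hs_norm_nonneg[OF minus_carrier_mat] intro: SO_carrier)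
  have "\<bar>a - b\<bar> \<le> \<epsilon>"
    using le[OF s t(1)] in_SO s t(1) by (simp add: mdist_SO a_def b_def)
  have "\<bar>?u t - ?v t\<bar> \<le> 10"
    using abs_triangle_ineq4[of "?u t" "?v t"] t' by linarith
  \<comment> \<open>The error is twice the difference of the traces, hence at most 2 * (5 + 5) =
    20.\<close>
  moreover have "2 * (real n - real m) = (a\<^sup>2 - b\<^sup>2) + 2 * (?u t - ?v t)"
    unfolding a2 b2 by simp
  ultimately have "2 * \<bar>real n - real m\<bar> - 20 \<le> \<bar>a\<^sup>2 - b\<^sup>2\<bar>"
    by (smt (verit))
  also have "\<bar>a\<^sup>2 - b\<^sup>2\<bar> = \<bar>a - b\<bar> * (a + b)"
    using ab by (simp add: power2_eq_square square_diff_square_factored abs_mult)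
  \<comment> \<open>Traces of modulus below 5 bound the squares of \<open>a\<close> and
    \<open>b\<close> by \<open>2 * n + 10\<close> and \<open>2 * m + 10\<close>.\<close>
  also have "\<dots> \<le> \<epsilon> * (sqrt (2 * real n + 10) + sqrt (2 * real m + 10))"
    using \<open>\<bar>a - b\<bar> \<le> \<epsilon>\<close> a2 b2 t' ab
    by (intro mult_mono add_mono real_le_rsqrt) auto
  finally show ?thesis .
qed

text \<open>An admissible \<epsilon> below \<open>c\<close> would also be below 1/2, and the
  necessary condition on admissible values would then contradict the strict inequality
  \<open>gap\<close>.\<close>

lemma box_dist_SO_ge:
  assumes haar: "haar_prob_SO n \<mu>" "haar_prob_SO m \<nu>" and c: "c \<le> 1 / 2"
    and gap: "c * (sqrt (2 * real n + 10) + sqrt (2 * real m + 10)) < 2 * \<bar>real n - real m\<bar> - 20"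
  shows "ereal c \<le> box_dist (SO_metric n, \<mu>) (SO_metric m, \<nu>)"
  unfolding box_dist_def box1_def fst_conv
proof (intro INF_greatest Inf_greatest, clarify)
  fix \<phi> \<psi> \<epsilon> T
  assume \<phi>\<psi>: "\<phi> \<in> parameters (SO_metric n, \<mu>)" "\<psi> \<in> parameters (SO_metric m, \<nu>)"
    and T: "T \<in> sets lebesgue" "T \<subseteq> {0..1}" "1 - \<epsilon> \<le> measure lebesgue T" and \<epsilon>: "0 < \<epsilon>"
    and le: "\<forall>s\<in>T. \<forall>t\<in>T. \<bar>mdist (SO_metric n) (\<phi> s) (\<phi> t) - mdist (SO_metric m) (\<psi> s) (\<psi> t)\<bar> \<le> \<epsilon>"
  have "c \<le> \<epsilon>"
  proof (rule ccontr)
    assume "\<not> c \<le> \<epsilon>"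
    then have "2 * \<bar>real n - real m\<bar> - 20 \<le> \<epsilon> * (sqrt (2 * real n + 10) + sqrt (2 * real m + 10))"
      using le c by (intro box_admissible_SO[OF haar \<phi>\<psi> T \<epsilon>]) auto
    also have "\<dots> \<le> c * (sqrt (2 * real n + 10) + sqrt (2 * real m + 10))"
      using \<open>\<not> c \<le> \<epsilon>\<close> by (intro mult_right_mono) auto
    finally show False using gap by linarith
  qed
  then show "ereal c \<le> ereal \<epsilon>" by simp
qed

section \<open>Asymptotics in \<open>k\<close>\<close>

lemma sqrt_twice_linear_le:
  assumes "x \<le> C * k" "0 \<le> C" "0 \<le> k"
  shows "sqrt (2 * x + 10) \<le> 3 / 2 * sqrt C * sqrt k + 4"
proof -
  \<comment> \<open>The factor 3/2 lies between sqrt 2 and 2: its square 9/4 covers the coefficient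
    of \<open>x\<close>, and staying below 2 leaves part of the dimension gap free to absorb
    constants later. The summand 4 covers the 10.\<close>
  have "(3 / 2 * sqrt C * sqrt k + 4)\<^sup>2 = 9 / 4 * (C * k) + 16 + 12 * sqrt C * sqrt k"
    using assms by (simp add: power2_eq_square algebra_simps)
  moreover have "0 \<le> C * k" "0 \<le> 12 * sqrt C * sqrt k" using assms by simp_all
  ultimately have "2 * x + 10 \<le> (3 / 2 * sqrt C * sqrt k + 4)\<^sup>2" using assms(1) by linarith
  then show ?thesis using assms by (intro real_le_lsqrt) simp_all
qed

text \<open>The growth conditions are required only eventually, so that the case of a gap of order
  \<open>k powr \<alpha>\<close> can reuse the bound with a constant \<open>C\<close> of its
  own.\<close>

lemma liminf_box_dist_SO_ge:
  fixes n m :: "nat \<Rightarrow> nat" and C1 C2 C :: real and \<mu> :: "nat \<Rightarrow> real mat measure"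
  assumes haar: "\<And>N. N \<ge> 1 \<Longrightarrow> haar_prob_SO N (\<mu> N)"
    and pos: "C1 > 0" "C2 > 0" "C > 0"
    and n: "eventually (\<lambda>k. 1 \<le> n k \<and> real (n k) \<le> C1 * real k) sequentially"
    and m: "eventually (\<lambda>k. 1 \<le> m k \<and> real (m k) \<le> C2 * real k) sequentially"
    and gap: "eventually (\<lambda>k. C * sqrt (real k) \<le> \<bar>real (n k) - real (m k)\<bar>) sequentially"
  shows "ereal (min (1 / 2) (C / (sqrt C1 + sqrt C2))) \<le>
    liminf (\<lambda>k. box_dist (SO_metric (n k), \<mu> (n k)) (SO_metric (m k), \<mu> (m k)))"
proof (rule Liminf_bounded)
  define c where "c = min (1 / 2) (C / (sqrt C1 + sqrt C2))"
  have c: "0 \<le> c" "c \<le> 1 / 2" "c \<le> C / (sqrt C1 + sqrt C2)"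
    unfolding c_def using pos by (simp, intro min.cobounded1, intro min.cobounded2)
  have "0 < sqrt C1 + sqrt C2" using pos by (simp add: add_pos_pos)
  then have cC: "c * (sqrt C1 + sqrt C2) \<le> C"
    using c(3) by (simp add: pos_le_divide_eq)
  \<comment> \<open>The final comparison has a surplus of \<open>(2 - 3/2) * C * sqrt k\<close>
    against constants 20 + 4, which requires \<open>sqrt k\<close> to exceed 48 /
    \<open>C\<close>.\<close>
  have large: "eventually (\<lambda>k. 48 / C < sqrt (real k)) sequentially"
    using filterlim_compose[OF sqrt_at_top filterlim_real_sequentially]
    by (simp add: filterlim_at_top_dense)
  show "eventually (\<lambda>k. ereal (min (1 / 2) (C / (sqrt C1 + sqrt C2))) \<le>
    box_dist (SO_metric (n k), \<mu> (n k)) (SO_metric (m k), \<mu> (m k))) sequentially"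
    using n m gap large unfolding c_def[symmetric]
  proof eventually_elim
    case (elim k)
    let ?x = "sqrt (real k)"
    have "c * (sqrt (2 * real (n k) + 10) + sqrt (2 * real (m k) + 10))
      \<le> c * ((3 / 2 * sqrt C1 * ?x + 4) + (3 / 2 * sqrt C2 * ?x + 4))"
      using elim pos c by (intro mult_left_mono add_mono sqrt_twice_linear_le) auto
    also have "\<dots> = 3 / 2 * (c * (sqrt C1 + sqrt C2)) * ?x + 8 * c"
      by (simp add: algebra_simps)
    \<comment> \<open>The summand 4 comes from \<open>c \<le> 1 / 2\<close>.\<close>
    also have "\<dots> \<le> 3 / 2 * C * ?x + 4"
      using cC c by (intro add_mono mult_right_mono) auto
    also have "\<dots> < 2 * (C * ?x) - 20"
      using elim(4) pos by (simp add: field_simps)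
    also have "\<dots> \<le> 2 * \<bar>real (n k) - real (m k)\<bar> - 20"
      using elim(3) by simp
    finally show ?case
      using elim by (intro box_dist_SO_ge haar c(2)) auto
  qed
qed

theorem proposition1p2:
  fixes n m :: "nat \<Rightarrow> nat" and C1 C2 C3 :: real and \<mu> :: "nat \<Rightarrow> real mat measure"
  assumes haar: "\<And>N. N \<ge> 1 \<Longrightarrow> haar_prob_SO N (\<mu> N)"
    and pos: "C1 > 0" "C2 > 0" "C3 > 0"
    and n_pos: "\<And>k. k \<ge> 1 \<Longrightarrow> n k \<ge> 1"
    and m_pos: "\<And>k. k \<ge> 1 \<Longrightarrow> m k \<ge> 1"
    and n_le: "\<And>k. k \<ge> 1 \<Longrightarrow> real (n k) \<le> C1 * real k"
    and m_le: "\<And>k. k \<ge> 1 \<Longrightarrow> real (m k) \<le> C2 * real k"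
    and gap: "\<And>k. k \<ge> 1 \<Longrightarrow> \<bar>real (n k) - real (m k)\<bar> \<ge> C3 * sqrt (real k)"
  shows "liminf (\<lambda>k. box_dist (SO_metric (n k), \<mu> (n k)) (SO_metric (m k), \<mu> (m k)))
           \<ge> ereal (min (1 / 2) (C3 / (sqrt C1 + sqrt C2)))
    \<and> (\<forall>C4 \<alpha> :: real. C4 > 0 \<longrightarrow> \<alpha> > 1 / 2 \<longrightarrow>
         (\<forall>k\<ge>1. \<bar>real (n k) - real (m k)\<bar> \<ge> C4 * real k powr \<alpha>) \<longrightarrow>
         liminf (\<lambda>k. box_dist (SO_metric (n k), \<mu> (n k)) (SO_metric (m k), \<mu> (m k)))
           \<ge> ereal (1 / 2))"
proof (intro conjI allI impI)
  have n: "eventually (\<lambda>k. 1 \<le> n k \<and> real (n k) \<le> C1 * real k) sequentially"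
    using n_pos n_le by (auto simp: eventually_sequentially)
  have m: "eventually (\<lambda>k. 1 \<le> m k \<and> real (m k) \<le> C2 * real k) sequentially"
    using m_pos m_le by (auto simp: eventually_sequentially)
  note liminf_ge = liminf_box_dist_SO_ge[where \<mu> = \<mu>, OF haar pos(1,2) _ n m]
  show "ereal (min (1 / 2) (C3 / (sqrt C1 + sqrt C2)))
      \<le> liminf (\<lambda>k. box_dist (SO_metric (n k), \<mu> (n k)) (SO_metric (m k), \<mu> (m k)))"
    using gap by (intro liminf_ge pos(3)) (auto simp: eventually_sequentially)
  fix C4 \<alpha> :: real
  assume C4: "C4 > 0" and \<alpha>: "\<alpha> > 1 / 2"
    and gap': "\<forall>k\<ge>1. C4 * real k powr \<alpha> \<le> \<bar>real (n k) - real (m k)\<bar>"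
  \<comment> \<open>With this choice the quotient in the general bound is exactly 1/2. As \<alpha> >
    1/2, the gap eventually dominates \<open>C * sqrt k\<close>.\<close>
  define C where "C = (sqrt C1 + sqrt C2) / 2"
  have sC: "0 < sqrt C1 + sqrt C2" using pos by (simp add: add_pos_pos)
  have "filterlim (\<lambda>k. real k powr (\<alpha> - 1 / 2)) at_top sequentially"
    using \<alpha> by (intro filterlim_compose[OF real_powr_at_top filterlim_real_sequentially]) simp
  then have "eventually (\<lambda>k. C / C4 \<le> real k powr (\<alpha> - 1 / 2)) sequentially"
    by (simp add: filterlim_at_top)
  then have "eventually (\<lambda>k. C * sqrt (real k) \<le> \<bar>real (n k) - real (m k)\<bar>) sequentially"
    using eventually_ge_at_top[of 1]
  proof eventually_elim
    case (elim k)
    have "C * sqrt (real k) \<le> C4 * real k powr (\<alpha> - 1 / 2) * sqrt (real k)"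
      using elim(1) C4 by (intro mult_right_mono) (auto simp: field_simps)
    also have "\<dots> = C4 * real k powr \<alpha>"
      using elim(2) by (simp add: powr_half_sqrt[symmetric] mult.assoc flip: powr_add)
    also have "\<dots> \<le> \<bar>real (n k) - real (m k)\<bar>" using gap' elim(2) by simp
    finally show ?case .
  qed
  then have "ereal (min (1 / 2) (C / (sqrt C1 + sqrt C2)))
      \<le> liminf (\<lambda>k. box_dist (SO_metric (n k), \<mu> (n k)) (SO_metric (m k), \<mu> (m k)))"
    using sC by (intro liminf_ge) (auto simp: C_def)
  also have "C / (sqrt C1 + sqrt C2) = 1 / 2" using sC by (simp add: C_def)
  finally show "ereal (1 / 2)
      \<le> liminf (\<lambda>k. box_dist (SO_metric (n k), \<mu> (n k)) (SO_metric (m k), \<mu> (m k)))"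
    by simp
qed

end
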